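(* There exist an instance $P$ and learned parameter vectors $\mathbf{w},\mathbf{w}^*$, where $\mathbf{w}$ is $\tau$-approximate with respect to $\mathbf{w}^*$, such that using proportional allocation with $\mathbf{w}^*$ obtains a MinMax objective of $O(1)$, while even when $\mathbf{w}$ is known offline, any online algorithm achieves a MinMax objective of $\Omega(\log\tau)$.
   Context: There are $n$ divisible items that arrive online and $m$ agents. An instance is a matrix $P=(p_{i,j})\in\mathbb{R}_{>0}^{m\times n}$, where $p_{i,j}$ is the weight (cost) of item $j$ for agent $i$, revealed when item $j$ arrives. An allocation is $x_{i,j}\in[0,1]$ with $\sum_i x_{i,j}=1$ for every $j$; the load of agent $i$ is $\sum_j p_{i,j}x_{i,j}$. The MinMax (load balancing) objective, to be minimized, is the maximum load over all agents. An online algorithm must fix the allocation of each item when it arrives; information "known offline" is available to it in advance. Learned parameter vectors are elements of $\mathbb{R}_{>0}^m$. Proportional allocation with parameter vector $\mathbf{w}$ sets $x_{i,j}=\dfrac{p_{i,j}^{\alpha}w_i}{\sum_{i'}p_{i',j}^{\alpha}w_{i'}}$, where $\alpha$ is a fixed exponent depending only on the objective (a negative number of large absolute value for MinMax). $\mathbf{w}$ is $\tau$-approximate with respect to $\mathbf{w}^*$ if $\frac{w_{i'}}{w_i}\le\tau\cdot\frac{w^*_{i'}}{w^*_i}$ for any two agents $i,i'$. Here $\tau\ge 1$ is the error parameter, and $O(\cdot)$, $\Omega(\cdot)$ are asymptotic in $\tau$. *)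

theory Defs
  imports Complex_Main "Jordan_Normal_Form.Matrix"
begin

text \<open>
  Agents are the row indices and items the column indices of an instance matrix; items arrive in
  the order of the columns. The number of agents is not fixed in advance, hence matrices and
  vectors with explicit dimensions.
\<close>

definition load_instance :: "nat \<Rightarrow> nat \<Rightarrow> real mat \<Rightarrow> bool" where
  "load_instance m n P \<longleftrightarrow>
     P \<in> carrier_mat m n \<and> (\<forall>i<m. \<forall>j<n. 0 < P $$ (i, j))"

definition pos_vec :: "nat \<Rightarrow> real vec \<Rightarrow> bool" where
  "pos_vec m v \<longleftrightarrow> v \<in> carrier_vec m \<and> (\<forall>i<m. 0 < v $ i)"

definition item_allocation :: "nat \<Rightarrow> real vec \<Rightarrow> bool" where
  "item_allocation m x \<longleftrightarrow>
     x \<in> carrier_vec m \<and> (\<forall>i<m. 0 \<le> x $ i \<and> x $ i \<le> 1) \<and> (\<Sum>i<m. x $ i) = 1"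

definition load :: "real mat \<Rightarrow> real mat \<Rightarrow> nat \<Rightarrow> real" where
  "load P X i = (\<Sum>j<dim_col P. P $$ (i, j) * X $$ (i, j))"

definition minmax_objective :: "real mat \<Rightarrow> real mat \<Rightarrow> real" where
  "minmax_objective P X = Max (load P X ` {..<dim_row P})"

definition proportional_allocation :: "real \<Rightarrow> real mat \<Rightarrow> real vec \<Rightarrow> real mat" where
  "proportional_allocation \<alpha> P w = mat (dim_row P) (dim_col P)
     (\<lambda>(i, j). P $$ (i, j) powr \<alpha> * w $ i / (\<Sum>i'<dim_row P. P $$ (i', j) powr \<alpha> * w $ i'))"

definition approximate_wrt :: "nat \<Rightarrow> real \<Rightarrow> real vec \<Rightarrow> real vec \<Rightarrow> bool" where
  "approximate_wrt m \<tau> w w' \<longleftrightarrow>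
     (\<forall>i<m. \<forall>i'<m. w $ i' / w $ i \<le> \<tau> * (w' $ i' / w' $ i))"

text \<open>
  A (deterministic) online algorithm for \<open>m\<close> agents maps the nonempty list of the weight vectors
  of all items that have arrived so far to the allocation of the most recent one, which is the last
  element of the list. Its own earlier decisions are determined by the prefixes of this list.
  Information known offline is not an argument: the algorithm may depend on everything that is
  quantified before it.
\<close>

definition online_algorithm :: "nat \<Rightarrow> (real vec list \<Rightarrow> real vec) \<Rightarrow> bool" where
  "online_algorithm m A \<longleftrightarrow>
     (\<forall>ps. ps \<noteq> [] \<and> (\<forall>p\<in>set ps. pos_vec m p) \<longrightarrow> item_allocation m (A ps))"

definition online_allocation :: "(real vec list \<Rightarrow> real vec) \<Rightarrow> real mat \<Rightarrow> real mat" where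
  "online_allocation A P = mat (dim_row P) (dim_col P)
     (\<lambda>(i, j). A (map (col P) [0..<Suc j]) $ i)"

end

theory Submission
  imports Defs
begin

text \<open>
  The adversary uses \<open>m = \<lfloor>\<tau>\<rfloor>\<close> agents and \<open>m\<close> items. An item costs \<open>1\<close> for the agents that are still
  active and a huge \<open>M\<close> for the others; after each item, the least loaded active agent is
  eliminated. Removing a minimum does not decrease the average load of the active agents, so
  the last one ends up with a load of order \<open>1/m + 1/(m-1) + \<dots> + 1 \<ge> ln \<tau>\<close>, unless the algorithm
  already pays a lot for using inactive agents. In hindsight, giving weight \<open>m - t\<close> to the agent
  eliminated after item \<open>t\<close> yields loads bounded by a telescoping sum, and all these weights are
  within a factor \<open>m \<le> \<tau>\<close> of the uniform vector.
\<close>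

section \<open>Averages under elimination of the least loaded agent\<close>

text \<open>A minimizer of \<open>f\<close> lies at or below the average. The two averages are
  compared in cross-multiplied form.\<close>

lemma average_le_average_remove:
  fixes f :: "'a \<Rightarrow> real"
  assumes "finite S" "2 \<le> card S"
  obtains e where "e \<in> S"
    "(real (card S) - 1) * sum f S \<le> real (card S) * sum f (S - {e})"
proof -
  from assms have "S \<noteq> {}" by auto
  with assms(1) have "Min (f ` S) \<in> f ` S" by simp
  then obtain e where "e \<in> S" "f e = Min (f ` S)" by force
  then have e: "e \<in> S" "\<And>i. i \<in> S \<Longrightarrow> f e \<le> f i" using assms(1) by auto
  have "real (card S) * f e \<le> sum f S"
    using sum_bounded_below[of S "f e" f] e by simp
  moreover have "sum f S = f e + sum f (S - {e})"
    using assms(1) e(1) by (simp add: sum.remove)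
  ultimately show ?thesis
    using that[OF e(1)] by (simp add: algebra_simps)
qed

text \<open>Here \<open>a ys i\<close> is the share of agent \<open>i\<close> in the item released after the eliminations \<open>ys\<close>.\<close>

lemma exists_partial_elimination_order:
  fixes a :: "'a list \<Rightarrow> 'a \<Rightarrow> real"
  assumes "finite S" "k < card S"
  shows "\<exists>xs. distinct xs \<and> set xs \<subseteq> S \<and> length xs = k \<and>
    (real (card S) - real k) *
      (\<Sum>r\<le>k. (\<Sum>i\<in>S - set (take r xs). a (take r xs) i) / (real (card S) - real r))
    \<le> (\<Sum>i\<in>S - set xs. \<Sum>r\<le>k. a (take r xs) i)"
  using assms(2)
\<comment> \<open>Divided by \<open>card S - k\<close>, the invariant bounds the average load of the
  survivors from below. Item \<open>k\<close> is already counted, since it is released after the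
  \<open>k\<close> eliminations in \<open>xs\<close>.\<close>
proof (induction k)
  case 0
  then show ?case by simp
next
  case (Suc k)
  let ?n = "real (card S)"
  define act where "act ys = (\<Sum>i\<in>S - set ys. a ys i)" for ys
  from Suc obtain xs where xs: "distinct xs" "set xs \<subseteq> S" "length xs = k" and
    avg: "(?n - real k) * (\<Sum>r\<le>k. act (take r xs) / (?n - real r))
      \<le> (\<Sum>i\<in>S - set xs. \<Sum>r\<le>k. a (take r xs) i)"
    unfolding act_def by auto
  define T where "T = S - set xs"
  define f where "f i = (\<Sum>r\<le>k. a (take r xs) i)" for i
  define q where "q = (\<Sum>r\<le>k. act (take r xs) / (?n - real r))"
  have finT: "finite T" using assms(1) by (simp add: T_def)
  have cardT: "card T = card S - k"
    unfolding T_def using xs by (simp add: card_Diff_subset distinct_card)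
  then have "2 \<le> card T" using Suc.prems by simp
  then obtain e where e: "e \<in> T" and
    le: "(real (card T) - 1) * sum f T \<le> real (card T) * sum f (T - {e})"
    using average_le_average_remove finT by blast
  define ys where "ys = xs @ [e]"
  have take_ys: "take r ys = take r xs" if "r \<le> k" for r
    using that xs(3) by (simp add: ys_def)
  have take_Suc: "take (Suc k) ys = ys" using xs(3) by (simp add: ys_def)
  have T': "T - {e} = S - set ys" by (auto simp: T_def ys_def)
  have rT: "real (card T) = ?n - real k" using cardT Suc.prems by simp
  define d where "d = ?n - real k"
  have d: "d > 1" using Suc.prems by (simp add: d_def)
  \<comment> \<open>Removing \<open>e\<close> does not lower the average load of the
    \<open>d\<close> survivors, so the bound \<open>q\<close> on it persists for the remaining
    \<open>d - 1\<close>.\<close>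
  have "(d - 1) * (d * q) \<le> (d - 1) * sum f T"
    using avg d by (intro mult_left_mono) (auto simp: d_def q_def f_def T_def)
  also have "\<dots> \<le> d * sum f (T - {e})" using le rT by (simp add: d_def)
  finally have "d * ((d - 1) * q) \<le> d * sum f (T - {e})" by (simp add: algebra_simps)
  then have key: "(d - 1) * q \<le> sum f (T - {e})" using d by simp
  \<comment> \<open>The new item's active share is divided by \<open>d - 1\<close>, the number of
    agents still active, which cancels the prefactor.\<close>
  have "(?n - real (Suc k)) * (\<Sum>r\<le>Suc k. act (take r ys) / (?n - real r))
      = (d - 1) * (q + act ys / (d - 1))"
    using take_ys take_Suc by (simp add: q_def d_def algebra_simps)
  also have "\<dots> = (d - 1) * q + act ys" using d by (simp add: field_simps)
  also have "\<dots> \<le> sum f (T - {e}) + act ys" using key by simp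
  also have "\<dots> = (\<Sum>i\<in>S - set ys. \<Sum>r\<le>Suc k. a (take r ys) i)"
    using take_ys take_Suc by (simp add: f_def act_def T' sum.distrib)
  finally have "(?n - real (Suc k)) * (\<Sum>r\<le>Suc k. act (take r ys) / (?n - real r))
      \<le> (\<Sum>i\<in>S - set ys. \<Sum>r\<le>Suc k. a (take r ys) i)" .
  moreover have "distinct ys" "set ys \<subseteq> S" "length ys = Suc k"
    using xs e by (auto simp: ys_def T_def)
  ultimately show ?case unfolding act_def by blast
qed

text \<open>With one survivor left, the average is that agent's own load. Appending the survivor
  makes the order enumerate \<open>S\<close> and leaves all prefixes shorter than
  \<open>card S\<close> unchanged.\<close>

lemma exists_elimination_order:
  fixes a :: "'a list \<Rightarrow> 'a \<Rightarrow> real"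
  assumes "finite S" "S \<noteq> {}"
  obtains xs where "distinct xs" "set xs = S"
    "(\<Sum>r<card S. (\<Sum>i\<in>S - set (take r xs). a (take r xs) i) / (real (card S) - real r))
      \<le> (\<Sum>r<card S. a (take r xs) (last xs))"
proof -
  obtain k where k: "card S = Suc k"
    using assms by (metis card_0_eq not0_implies_Suc)
  then obtain xs where xs: "distinct xs" "set xs \<subseteq> S" "length xs = k" and
    le: "(\<Sum>r\<le>k. (\<Sum>i\<in>S - set (take r xs). a (take r xs) i) / (real (card S) - real r))
      \<le> (\<Sum>i\<in>S - set xs. \<Sum>r\<le>k. a (take r xs) i)"
    using exists_partial_elimination_order[OF assms(1), of k a] by auto
  have "card (S - set xs) = 1"
    using xs k by (simp add: card_Diff_subset distinct_card)
  then obtain e where e: "S - set xs = {e}" by (auto simp: card_1_singleton_iff)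
  define ys where "ys = xs @ [e]"
  have take_ys: "take r ys = take r xs" if "r \<le> k" for r
    using that xs(3) by (simp add: ys_def)
  have "distinct ys" "set ys = S" using xs e by (auto simp: ys_def)
  moreover have "last ys = e" by (simp add: ys_def)
  ultimately show ?thesis
    using that[of ys] le by (simp add: k e lessThan_Suc_atMost take_ys)
qed

section \<open>Telescoping, triangular and harmonic sums\<close>

text \<open>Telescoping of \<open>1 / d - 1 / (d + 1)\<close> with \<open>d = m - j\<close>. Up to a
  factor, the sum bounds the hindsight load of an agent from its cheap items.\<close>

lemma sum_inverse_consecutive_products:
  fixes m t :: nat
  assumes "t < m"
  shows "(\<Sum>j\<le>t. 1 / ((real m - real j) * (real m - real j + 1)))
    = 1 / (real m - real t) - 1 / (real m + 1)"
  using assms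
proof (induction t)
  case 0
  then show ?case by (simp add: field_simps)
next
  case (Suc t)
  define d where "d = real m - (1 + real t)"
  have "0 < d" using Suc.prems by (simp add: d_def)
  then have "1 / (d + 1) + 1 / (d * (d + 1)) = 1 / d"
    by (simp add: divide_simps)
  with Suc show ?case by (simp add: d_def add.commute)
qed

text \<open>The terms run from \<open>m - j\<close> down to \<open>1\<close>; they are the hindsight
  weights of the agents active at item \<open>j\<close>.\<close>

lemma sum_remaining_ranks:
  fixes m j :: nat
  assumes "j \<le> m"
  shows "(\<Sum>t=j..<m. real m - real t) = (real m - real j) * (real m - real j + 1) / 2"
  using assms
proof (induction rule: inc_induct)
  case (step n)
  then show ?case by (simp add: sum.atLeast_Suc_lessThan field_simps)
qed simp

lemma ln_le_sum_inverse: "ln (real m + 1) \<le> (\<Sum>r<m. 1 / real (Suc r))"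
proof (induction m)
  case (Suc m)
  have "real (Suc m) + 1 = (real m + 1) * (1 + 1 / real (Suc m))"
    by (simp add: field_simps)
  then have "ln (real (Suc m) + 1) = ln (real m + 1) + ln (1 + 1 / real (Suc m))"
    by (simp add: ln_mult_pos add_pos_nonneg)
  also have "\<dots> \<le> (\<Sum>r<m. 1 / real (Suc r)) + 1 / real (Suc m)"
    by (intro add_mono Suc.IH ln_add_one_self_le_self) simp
  finally show ?case by simp
qed simp

lemma ln_le_sum_inverse_ranks: "ln (real m + 1) \<le> (\<Sum>r<m. 1 / (real m - real r))"
proof -
  have "(\<Sum>r<m. 1 / (real m - real r)) = (\<Sum>r<m. 1 / real (Suc r))"
    by (subst sum.nat_diff_reindex[symmetric], rule sum.cong) (auto simp: of_nat_diff)
  then show ?thesis using ln_le_sum_inverse by simp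
qed

section \<open>The adversarial instance and its hindsight weights\<close>

text \<open>Column \<open>j\<close> depends only on the first \<open>j\<close> eliminations, so it
  can be revealed before the later ones are chosen. For distinct \<open>xs\<close>, agent
  \<open>xs ! t\<close> pays \<open>1\<close> exactly for the items up to and including
  \<open>t\<close>.\<close>

definition elimination_matrix :: "real \<Rightarrow> nat list \<Rightarrow> real mat" where
  "elimination_matrix M xs = mat (length xs) (length xs)
     (\<lambda>(i, j). if i \<in> set (take j xs) then M else 1)"

text \<open>\<open>inv_into\<close> recovers the position of an agent in the order. Agents
  eliminated early have few cheap items and can afford larger shares of them.\<close>

definition elimination_weights :: "nat list \<Rightarrow> real vec" where
  "elimination_weights xs = vec (length xs)
     (\<lambda>i. real (length xs) - real (inv_into {..<length xs} ((!) xs) i))"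

lemma minmax_objective_ge_load:
  assumes "i < dim_row P"
  shows "load P X i \<le> minmax_objective P X"
  unfolding minmax_objective_def using assms by (intro Max_ge) auto

lemma minmax_objective_le:
  assumes "0 < dim_row P" "\<And>i. i < dim_row P \<Longrightarrow> load P X i \<le> C"
  shows "minmax_objective P X \<le> C"
  unfolding minmax_objective_def using assms by (subst Max_le_iff) auto

context
  fixes m :: nat and xs :: "nat list"
  assumes xs: "distinct xs" "set xs = {..<m}"
begin

lemma length_order: "length xs = m"
  using xs distinct_card by fastforce

lemma nth_order_less: "t < m \<Longrightarrow> xs ! t < m"
  by (metis xs(2) length_order lessThan_iff nth_mem)

lemma bij_betw_order: "bij_betw ((!) xs) {..<m} {..<m}"
  by (rule bij_betw_nth) (use xs length_order in auto)

lemma nth_order_in_take_iff: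
  assumes "t < m" "j < m"
  shows "xs ! t \<in> set (take j xs) \<longleftrightarrow> t < j"
  using assms length_order xs(1)
  by (auto simp: in_set_conv_nth nth_eq_iff_index_eq)

lemma elimination_weights_nth:
  assumes "t < m"
  shows "elimination_weights xs $ (xs ! t) = real m - real t"
  using assms nth_order_less bij_betw_order length_order
  by (simp add: elimination_weights_def bij_betw_def inv_into_f_f)

lemma elimination_matrix_nth:
  assumes "t < m" "j < m"
  shows "elimination_matrix M xs $$ (xs ! t, j) = (if t < j then M else 1)"
  using assms nth_order_less length_order nth_order_in_take_iff
  by (simp add: elimination_matrix_def)

lemma order_cases:
  assumes "i < m" obtains t where "t < m" "i = xs ! t"
  using assms bij_betw_order by (metis bij_betw_imp_surj_on imageE lessThan_iff)

lemma elimination_weights_bounds: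
  assumes "i < m"
  shows "1 \<le> elimination_weights xs $ i" "elimination_weights xs $ i \<le> real m"
proof -
  obtain t where "t < m" "i = xs ! t" using order_cases assms by blast
  then show "1 \<le> elimination_weights xs $ i" "elimination_weights xs $ i \<le> real m"
    by (auto simp: elimination_weights_nth)
qed

section \<open>Upper bound for the proportional allocation\<close>

text \<open>After reindexing by elimination position, only the active positions
  \<open>t \<ge> j\<close> are kept: their cost \<open>1\<close> leaves the bare weights, and the
  dropped terms are nonnegative.\<close>

lemma proportional_denominator_ge:
  assumes "j < m" "0 < M"
  shows "(real m - real j) * (real m - real j + 1) / 2 \<le>
    (\<Sum>i<m. elimination_matrix M xs $$ (i, j) powr \<alpha> * elimination_weights xs $ i)"
proof -
  let ?g = "\<lambda>t. (if t < j then M else 1) powr \<alpha> * (real m - real t)"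
  have "(\<Sum>i<m. elimination_matrix M xs $$ (i, j) powr \<alpha> * elimination_weights xs $ i)
      = (\<Sum>t<m. ?g t)"
    using assms elimination_weights_nth elimination_matrix_nth
    by (subst sum.reindex_bij_betw[OF bij_betw_order, symmetric]) (auto intro!: sum.cong)
  moreover have "(\<Sum>t=j..<m. real m - real t) = (\<Sum>t=j..<m. ?g t)"
    by (intro sum.cong) auto
  moreover have "(\<Sum>t=j..<m. ?g t) \<le> (\<Sum>t<m. ?g t)"
    by (intro sum_mono2) auto
  ultimately show ?thesis using sum_remaining_ranks[of j m] assms by simp
qed

text \<open>The bound is \<open>2 + 1\<close>: the cheap items telescope to at most
  \<open>2\<close>, and the expensive ones cost at most \<open>M powr (1 + \<alpha>) * m\<close>
  each, hence at most \<open>1\<close> in total.\<close>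

lemma proportional_load_le:
  assumes "i < m" "1 \<le> M" "M powr (1 + \<alpha>) * (real m)\<^sup>2 \<le> 1"
  shows "load (elimination_matrix M xs)
    (proportional_allocation \<alpha> (elimination_matrix M xs) (elimination_weights xs)) i \<le> 3"
proof -
  let ?P = "elimination_matrix M xs" and ?w = "elimination_weights xs"
  define D where "D j = (\<Sum>i<m. ?P $$ (i, j) powr \<alpha> * ?w $ i)" for j
  define b where "b j = (real m - real j) * (real m - real j + 1)" for j
  have dims: "dim_row ?P = m" "dim_col ?P = m"
    by (simp_all add: elimination_matrix_def length_order)
  obtain t where t: "t < m" "i = xs ! t" using order_cases assms(1) by blast
  have D: "b j / 2 \<le> D j" if "j < m" for j
    using proportional_denominator_ge[OF that, of M \<alpha>] assms(2) by (simp add: D_def b_def)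
  have b: "2 \<le> b j" if "j < m" for j
    using mult_mono[of 1 "real m - real j" 2 "real m - real j + 1"] that by (simp add: b_def)
  \<comment> \<open>The last term is granted to cheap items as well, so that the sum splits without
    a case distinction.\<close>
  have summand: "?P $$ (i, j) * (?P $$ (i, j) powr \<alpha> * ?w $ i / D j)
      \<le> (if j \<le> t then 2 * (real m - real t) * (1 / b j) else 0) + M powr (1 + \<alpha>) * real m"
    if j: "j < m" for j
  proof (cases "j \<le> t")
    case True
    have "(real m - real t) / D j \<le> (real m - real t) / (b j / 2)"
      using D[OF j] b[OF j] t by (intro divide_left_mono) (auto intro!: mult_pos_pos)
    moreover have "?P $$ (i, j) = 1" using True t j elimination_matrix_nth by simp
    moreover have "0 \<le> M powr (1 + \<alpha>) * real m" by simp
    ultimately show ?thesis using True t elimination_weights_nth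
      by (simp add: mult.commute add_increasing2)
  next
    case False
    have D1: "1 \<le> D j" using D[OF j] b[OF j] by simp
    have "?w $ i / D j \<le> real m / 1"
      using D1 elimination_weights_bounds[OF assms(1)] by (intro frac_le) auto
    then have "M powr (1 + \<alpha>) * (?w $ i / D j) \<le> M powr (1 + \<alpha>) * real m"
      by (intro mult_left_mono) auto
    moreover have "?P $$ (i, j) = M" using False t j elimination_matrix_nth by simp
    moreover have "M powr (1 + \<alpha>) = M * M powr \<alpha>" using assms(2) by (simp add: powr_add)
    ultimately show ?thesis using False by (simp add: mult.assoc)
  qed
  have "load ?P (proportional_allocation \<alpha> ?P ?w) i
      = (\<Sum>j<m. ?P $$ (i, j) * (?P $$ (i, j) powr \<alpha> * ?w $ i / D j))"
    using assms(1) by (simp add: load_def proportional_allocation_def dims D_def)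
  also have "\<dots> \<le> (\<Sum>j<m. (if j \<le> t then 2 * (real m - real t) * (1 / b j) else 0)
      + M powr (1 + \<alpha>) * real m)"
    using summand by (intro sum_mono) auto
  also have "\<dots> = (\<Sum>j<m. if j \<le> t then 2 * (real m - real t) * (1 / b j) else 0)
      + M powr (1 + \<alpha>) * (real m)\<^sup>2"
    by (simp add: sum.distrib power2_eq_square)
  also have "(\<Sum>j<m. if j \<le> t then 2 * (real m - real t) * (1 / b j) else 0)
      = (\<Sum>j\<le>t. 2 * (real m - real t) * (1 / b j))"
    using t(1) by (intro sum.mono_neutral_cong_right) auto
  also have "\<dots> = 2 * (real m - real t) * (1 / (real m - real t) - 1 / (real m + 1))"
    unfolding sum_distrib_left[symmetric] b_def
    using sum_inverse_consecutive_products[OF t(1)] by simp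
  also have "\<dots> = 2 - 2 * (real m - real t) / (real m + 1)"
    using t(1) by (simp add: right_diff_distrib[of "2 * (real m - real t)"]
        del: right_diff_distrib_numeral)
  also have "\<dots> \<le> 2" using t(1) by simp
  finally show ?thesis using assms(3) by simp
qed

lemma col_elimination_matrix:
  assumes "j < m"
  shows "col (elimination_matrix M xs) j = vec m (\<lambda>i. if i \<in> set (take j xs) then M else 1)"
  using assms by (intro eq_vecI) (auto simp: elimination_matrix_def length_order)

end

section \<open>Lower bound for online algorithms\<close>

text \<open>Either some eliminated agent receives a share costing at least
  \<open>m \<ge> ln (m + 1)\<close>, or the active agents receive at least half of every item and
  the last survivor collects half a harmonic sum.\<close>

lemma online_objective_ge:
  fixes m :: nat and M :: real
  assumes alg: "online_algorithm m A" and m: "1 \<le> m" and M: "2 * (real m)\<^sup>2 \<le> M"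
  obtains xs where "distinct xs" "set xs = {..<m}"
    "ln (real m + 1) / 2 \<le> minmax_objective (elimination_matrix M xs)
       (online_allocation A (elimination_matrix M xs))"
proof -
  define item where "item ys = vec m (\<lambda>i. if i \<in> set ys then M else 1)" for ys
  \<comment> \<open>The answer to the item released after the eliminations \<open>ys\<close>. The
    history has one item per prefix of \<open>ys\<close>, the empty one included.\<close>
  define a where "a ys = A (map (\<lambda>r. item (take r ys)) [0..<Suc (length ys)])" for ys
  have "0 < (real m)\<^sup>2" using m by simp
  then have M0: "0 < M" using M by linarith
  have alloc: "item_allocation m (a ys)" for ys
    using alg M0 unfolding online_algorithm_def a_def
    by (auto simp: pos_vec_def item_def)
  obtain xs where xs: "distinct xs" "set xs = {..<m}" and
    last_ge: "(\<Sum>r<m. (\<Sum>i\<in>{..<m} - set (take r xs). a (take r xs) $ i) / (real m - real r))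
      \<le> (\<Sum>r<m. a (take r xs) $ last xs)"
    using exists_elimination_order[of "{..<m}" "\<lambda>ys i. a ys $ i"] m
    by (auto simp: lessThan_empty_iff)
  let ?P = "elimination_matrix M xs"
  let ?X = "online_allocation A ?P"
  have len: "length xs = m" using length_order xs by blast
  have dims: "dim_row ?P = m" "dim_col ?P = m"
    by (simp_all add: elimination_matrix_def len)
  \<comment> \<open>Columns \<open>0\<close> to \<open>j\<close> of the final matrix are the history
    simulated by \<open>a (take j xs)\<close>, so the adaptively chosen order becomes a fixed
    instance.\<close>
  have X: "?X $$ (i, j) = a (take j xs) $ i" if "i < m" "j < m" for i j
  proof -
    have "map (col ?P) [0..<Suc j] = map (\<lambda>r. item (take r (take j xs))) [0..<Suc j]"
      using that by (intro map_cong) (auto simp: col_elimination_matrix[OF xs] item_def min_def)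
    also have "A \<dots> = a (take j xs)" using that len by (simp add: a_def)
    finally show ?thesis using that by (simp add: online_allocation_def dims)
  qed
  have share: "0 \<le> a ys $ i" if "i < m" for ys i
    using alloc that by (auto simp: item_allocation_def)
  have P: "?P $$ (i, j) = (if i \<in> set (take j xs) then M else 1)" if "i < m" "j < m" for i j
    using that by (simp add: elimination_matrix_def len)
  have load: "load ?P ?X i = (\<Sum>j<m. ?P $$ (i, j) * a (take j xs) $ i)" if "i < m" for i
    using that X by (simp add: load_def dims)
  have "ln (real m + 1) / 2 \<le> minmax_objective ?P ?X"
  proof (cases "\<exists>i<m. \<exists>j<m. i \<in> set (take j xs) \<and> real m \<le> M * a (take j xs) $ i")
    case True
    then obtain i j where ij: "i < m" "j < m" "i \<in> set (take j xs)"
      "real m \<le> M * a (take j xs) $ i" by blast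
    have "ln (real m + 1) / 2 \<le> ln (real m + 1)" by simp
    also have "\<dots> \<le> real m" using ln_add_one_self_le_self[of "real m"] by (simp add: add.commute)
    also have "\<dots> \<le> ?P $$ (i, j) * a (take j xs) $ i" using ij P by simp
    also have "\<dots> \<le> load ?P ?X i"
      unfolding load[OF ij(1)] using ij P share M0
      by (intro member_le_sum[of j "{..<m}"]) auto
    also have "\<dots> \<le> minmax_objective ?P ?X" using ij dims by (intro minmax_objective_ge_load) simp
    finally show ?thesis .
  next
    case False
    \<comment> \<open>At most \<open>m\<close> eliminated agents get less than \<open>m / M\<close>
      each, in total at most \<open>m^2 / M \<le> 1 / 2\<close>. This dictates the bound
      \<open>2 * m^2 \<le> M\<close>.\<close>
    have active: "1 / 2 \<le> (\<Sum>i\<in>{..<m} - set (take j xs). a (take j xs) $ i)" if j: "j < m" for j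
    proof -
      let ?E = "set (take j xs)"
      have sub: "?E \<subseteq> {..<m}" using xs(2) set_take_subset[of j xs] by simp
      have "(\<Sum>i\<in>?E. a (take j xs) $ i) \<le> (\<Sum>i\<in>?E. real m / M)"
        using False sub j M0 by (intro sum_mono) (auto simp: field_simps not_le intro: less_imp_le)
      also have "\<dots> = real (card ?E) * (real m / M)" by simp
      also have "\<dots> \<le> real m * (real m / M)"
        using card_mono[OF _ sub] M0 by (intro mult_right_mono) auto
      also have "\<dots> \<le> 1 / 2" using M M0 by (simp add: field_simps power2_eq_square)
      finally have "(\<Sum>i\<in>?E. a (take j xs) $ i) \<le> 1 / 2" .
      moreover have "(\<Sum>i<m. a (take j xs) $ i) = 1"
        using alloc by (simp add: item_allocation_def)
      ultimately show ?thesis using sub by (simp add: sum_diff)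
    qed
    \<comment> \<open>The survivor has position \<open>m - 1\<close> and no item comes later, so all
      its costs are \<open>1\<close> and its load is the sum of its shares.\<close>
    have last: "last xs = xs ! (m - 1)" "m - 1 < m"
      using m len last_conv_nth[of xs] by (cases xs; simp)+
    have last_less: "last xs < m" using last nth_order_less[OF xs] by metis
    have "ln (real m + 1) / 2 \<le> (\<Sum>r<m. 1 / (real m - real r)) / 2"
      using ln_le_sum_inverse_ranks[of m] by simp
    also have "\<dots> = (\<Sum>r<m. (1 / 2) / (real m - real r))"
      by (simp add: sum_divide_distrib mult.commute)
    also have "\<dots> \<le> (\<Sum>r<m. (\<Sum>i\<in>{..<m} - set (take r xs). a (take r xs) $ i) / (real m - real r))"
      using active by (intro sum_mono divide_right_mono) auto
    also have "\<dots> \<le> (\<Sum>r<m. a (take r xs) $ last xs)" by (rule last_ge)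
    also have "\<dots> = load ?P ?X (last xs)"
      unfolding load[OF last_less]
      using elimination_matrix_nth[OF xs last(2)] last(1) by (intro sum.cong) auto
    also have "\<dots> \<le> minmax_objective ?P ?X"
      using last_less dims by (intro minmax_objective_ge_load) simp
    finally show ?thesis .
  qed
  with xs that show ?thesis by blast
qed

section \<open>Choice of the large cost and conclusion\<close>

text \<open>A negative power tends to \<open>0\<close> at infinity. With exponent
  \<open>1 + \<alpha>\<close>, this makes expensive items harmless to the proportional
  allocation.\<close>

lemma exists_large_base_powr_le:
  fixes \<beta> B K :: real
  assumes "\<beta> < 0"
  obtains M where "B \<le> M" "M powr \<beta> * K \<le> 1"
proof -
  have "((\<lambda>M::real. M powr \<beta> * K) \<longlongrightarrow> 0 * K) at_top"
    using assms by (intro tendsto_mult_right tendsto_neg_powr filterlim_ident)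
  then have "\<forall>\<^sub>F M in at_top. M powr \<beta> * K < 1"
    by (intro order_tendstoD) auto
  with eventually_ge_at_top[of B] have "\<forall>\<^sub>F M in at_top. B \<le> M \<and> M powr \<beta> * K < 1"
    by (rule eventually_conj)
  then obtain M where "B \<le> M" "M powr \<beta> * K < 1"
    using eventually_happens'[OF trivial_limit_at_top_linorder] by blast
  then show ?thesis using that[of M] by simp
qed

theorem lemma5p6:
  fixes \<alpha> :: real
  assumes "\<alpha> < -1"
  shows "\<exists>c>0. \<exists>C>0. \<forall>\<^sub>F \<tau> :: real in at_top.
    \<exists>m n w. 1 \<le> m \<and> 1 \<le> n \<and> pos_vec m w \<and>
      (\<forall>A. online_algorithm m A \<longrightarrow>
        (\<exists>P w'. load_instance m n P \<and> pos_vec m w' \<and> approximate_wrt m \<tau> w w' \<and>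
          minmax_objective P (proportional_allocation \<alpha> P w') \<le> C \<and>
          c * ln \<tau> \<le> minmax_objective P (online_allocation A P)))"
proof -
  have main: "\<exists>m n w. 1 \<le> m \<and> 1 \<le> n \<and> pos_vec m w \<and>
      (\<forall>A. online_algorithm m A \<longrightarrow>
        (\<exists>P w'. load_instance m n P \<and> pos_vec m w' \<and> approximate_wrt m \<tau> w w' \<and>
          minmax_objective P (proportional_allocation \<alpha> P w') \<le> 3 \<and>
          (1 / 2) * ln \<tau> \<le> minmax_objective P (online_allocation A P)))"
    if \<tau>: "1 \<le> \<tau>" for \<tau> :: real
  proof -
    \<comment> \<open>Rounding down keeps the hindsight weights, which lie between \<open>1\<close>
      and \<open>m\<close>, within a factor \<open>\<tau>\<close> of each other, while
      \<open>\<tau> \<le> m + 1\<close> matches the bound \<open>ln (m + 1)\<close>.\<close>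
    define m where "m = nat \<lfloor>\<tau>\<rfloor>"
    \<comment> \<open>The uniform vector reveals nothing about the elimination order.\<close>
    define w :: "real vec" where "w = vec m (\<lambda>_. 1)"
    have m: "1 \<le> m" "real m \<le> \<tau>" "\<tau> \<le> real m + 1"
      using \<tau> by (auto simp: m_def le_nat_iff le_floor_iff)
    \<comment> \<open>The first condition serves both bounds, the second the upper one.
      \<open>M\<close> is fixed before the algorithm is given.\<close>
    obtain M where M: "max 1 (2 * (real m)\<^sup>2) \<le> M" "M powr (1 + \<alpha>) * (real m)\<^sup>2 \<le> 1"
      using exists_large_base_powr_le[of "1 + \<alpha>"] assms
      by (smt (verit))
    have "\<exists>P w'. load_instance m m P \<and> pos_vec m w' \<and> approximate_wrt m \<tau> w w' \<and>
          minmax_objective P (proportional_allocation \<alpha> P w') \<le> 3 \<and>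
          (1 / 2) * ln \<tau> \<le> minmax_objective P (online_allocation A P)"
      if A: "online_algorithm m A" for A
    proof -
      obtain xs where xs: "distinct xs" "set xs = {..<m}" and
        ge: "ln (real m + 1) / 2 \<le> minmax_objective (elimination_matrix M xs)
          (online_allocation A (elimination_matrix M xs))"
        using online_objective_ge[OF A m(1), of M] M(1) by auto
      let ?P = "elimination_matrix M xs" and ?w' = "elimination_weights xs"
      note len = length_order[OF xs] and bounds = elimination_weights_bounds[OF xs]
      have "load_instance m m ?P"
        using M(1) by (auto simp: load_instance_def elimination_matrix_def len)
      moreover have "pos_vec m ?w'"
        using bounds(1) by (force simp: pos_vec_def elimination_weights_def len)
      moreover have "approximate_wrt m \<tau> w ?w'"
        unfolding approximate_wrt_def
      proof (intro allI impI)
        fix i i' assume i: "i < m" "i' < m"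
        have "?w' $ i \<le> \<tau> * 1" using bounds(2)[OF i(1)] m(2) by simp
        also have "\<dots> \<le> \<tau> * ?w' $ i'" using bounds(1)[OF i(2)] \<tau> by (intro mult_left_mono) auto
        finally show "w $ i' / w $ i \<le> \<tau> * (?w' $ i' / ?w' $ i)"
          using bounds(1)[OF i(1)] i by (simp add: w_def field_simps)
      qed
      moreover have "minmax_objective ?P (proportional_allocation \<alpha> ?P ?w') \<le> 3"
        using proportional_load_le[OF xs _ _ M(2)] M(1) m(1)
        by (intro minmax_objective_le) (auto simp: elimination_matrix_def len)
      moreover have "(1 / 2) * ln \<tau> \<le> minmax_objective ?P (online_allocation A ?P)"
      proof -
        have "ln \<tau> \<le> ln (real m + 1)" using m(3) \<tau> by simp
        with ge show ?thesis by linarith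
      qed
      ultimately show ?thesis by blast
    qed
    moreover have "pos_vec m w" by (simp add: pos_vec_def w_def)
    ultimately show ?thesis using m(1) by blast
  qed
  show ?thesis
  proof (intro exI conjI)
    show "(0::real) < 1 / 2" "(0::real) < 3" by simp_all
  qed (rule eventually_mono[OF eventually_ge_at_top[of 1] main])
qed

end
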